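(* Let $R$ be a standard graded Noetherian ring with $R_0$ a field, and let $I$ be a non-zero proper graded ideal of $R$. Assume that $I$ has no embedded primes, i.e. $\operatorname{Ass}(R/I)=\operatorname{Min}(I)$. Let $t\ge 1$ and $M_t=I^{(t)}/I^t$. Then for every prime $P\in\operatorname{Emb}_t(I)$, $$\operatorname{v}_P(M_t)=\operatorname{v}_P(I^t).$$
   Context: For an ideal $I$ of a Noetherian ring $R$ and $t\ge 1$, the $t$-th symbolic power is $I^{(t)}=\left(\bigcap_{P\in \operatorname{Ass}(R/I)} I^tR_P\right)\cap R$, i.e. the set of $r\in R$ whose image in $R_P$ lies in $I^tR_P$ for every $P\in\operatorname{Ass}(R/I)$. $\operatorname{Emb}_t(I)=\operatorname{Ass}(R/I^t)\setminus \operatorname{Min}(I)$ is the set of embedded primes of $I^t$, where $\operatorname{Min}(I)$ is the set of minimal primes of $I$. For a finitely generated graded $R$-module $M$ and $P\in\operatorname{Ass}(M)$, the local v-number of $M$ at $P$ is $\operatorname{v}_P(M)=\min\{\deg m\mid m\in M \text{ homogeneous},\ \operatorname{ann}_R(m)=P\}$. For a graded ideal $J$, $\operatorname{v}_P(J)$ means $\operatorname{v}_P(R/J)$, i.e. $\min\{\deg f\mid f\in R\text{ homogeneous},\ J:f=P\}$. *)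

theory Defs
  imports
    "HOL-Algebra.Module"
    "HOL-Algebra.Ideal_Product"
    "HOL-Algebra.Generated_Rings"
    "HOL-Algebra.Ring_Divisibility"
    "HOL-Library.Extended_Nat"
begin

section \<open>Graded rings and graded ideals\<close>

text \<open>
  The grading is internal: \<open>A n\<close> is the homogeneous component of degree \<open>n\<close>, and the last
  assumption says that the ring is the direct sum of the \<open>A n\<close>.
\<close>

locale graded_ring = cring R for R (structure) +
  fixes A :: "nat \<Rightarrow> 'a set"
  assumes component_subgroup: "additive_subgroup (A n) R"
    and one_component: "\<one> \<in> A 0"
    and mult_component: "\<lbrakk> x \<in> A m; y \<in> A n \<rbrakk> \<Longrightarrow> x \<otimes> y \<in> A (m + n)"
    and direct_sum: "x \<in> carrier R \<Longrightarrow>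
      \<exists>!f. (\<forall>n. f n \<in> A n) \<and> finite {n. f n \<noteq> \<zero>} \<and> x = (\<Oplus>n\<in>{n. f n \<noteq> \<zero>}. f n)"

locale standard_graded_ring = graded_ring +
  assumes generated_in_degree_one: "generate_ring R (A 0 \<union> A 1) = carrier R"

definition graded_ideal :: "('a, 'b) ring_scheme \<Rightarrow> (nat \<Rightarrow> 'a set) \<Rightarrow> 'a set \<Rightarrow> bool" where
  "graded_ideal R A I \<longleftrightarrow> ideal I R \<and> I = genideal R (\<Union>n. I \<inter> A n)"


section \<open>Quotient modules\<close>

text \<open>
  The fields \<open>mult\<close> and \<open>one\<close> of a module record play no role in the theory of modules;
  below they are filled in as for quotient rings.
\<close>

definition regular_module :: "('a, 'b) ring_scheme \<Rightarrow> ('a, 'a) module" where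
  "regular_module R =
    \<lparr>carrier = carrier R, monoid.mult = (\<otimes>\<^bsub>R\<^esub>), one = \<one>\<^bsub>R\<^esub>,
     ring.zero = \<zero>\<^bsub>R\<^esub>, add = (\<oplus>\<^bsub>R\<^esub>), smult = (\<otimes>\<^bsub>R\<^esub>)\<rparr>"

definition quotient_module ::
    "('a, 'm, 'b) module_scheme \<Rightarrow> 'm set \<Rightarrow> ('a, 'm set) module" where
  "quotient_module M K =
    \<lparr>carrier = a_rcosets\<^bsub>M\<^esub> K, monoid.mult = rcoset_mult M K, one = K +>\<^bsub>M\<^esub> \<one>\<^bsub>M\<^esub>,
     ring.zero = K, add = set_add M, smult = (\<lambda>a X. \<Union>x\<in>X. K +>\<^bsub>M\<^esub> (a \<odot>\<^bsub>M\<^esub> x))\<rparr>"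

text \<open>\<open>N/J\<close> for ideals \<open>J \<subseteq> N\<close>, as an \<open>R\<close>-module; in particular \<open>R/J\<close> for \<open>N = R\<close>.\<close>

definition ideal_quotient :: "('a, 'b) ring_scheme \<Rightarrow> 'a set \<Rightarrow> 'a set \<Rightarrow> ('a, 'a set) module" where
  "ideal_quotient R N J = quotient_module ((regular_module R)\<lparr>carrier := N\<rparr>) J"

definition ideal_quotient_grading ::
    "('a, 'b) ring_scheme \<Rightarrow> (nat \<Rightarrow> 'a set) \<Rightarrow> 'a set \<Rightarrow> 'a set \<Rightarrow> nat \<Rightarrow> 'a set set" where
  "ideal_quotient_grading R A N J n = (\<lambda>f. J +>\<^bsub>R\<^esub> f) ` (N \<inter> A n)"


section \<open>Associated, minimal and embedded primes\<close>

definition annihilator ::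
    "('a, 'b) ring_scheme \<Rightarrow> ('a, 'm, 'c) module_scheme \<Rightarrow> 'm \<Rightarrow> 'a set" where
  "annihilator R M m = {r \<in> carrier R. r \<odot>\<^bsub>M\<^esub> m = \<zero>\<^bsub>M\<^esub>}"

definition Ass :: "('a, 'b) ring_scheme \<Rightarrow> ('a, 'm, 'c) module_scheme \<Rightarrow> 'a set set" where
  "Ass R M = {P. primeideal P R \<and> (\<exists>m\<in>carrier M. annihilator R M m = P)}"

definition minimal_primes :: "('a, 'b) ring_scheme \<Rightarrow> 'a set \<Rightarrow> 'a set set" where
  "minimal_primes R I = {P. primeideal P R \<and> I \<subseteq> P \<and>
     (\<forall>Q. primeideal Q R \<and> I \<subseteq> Q \<and> Q \<subseteq> P \<longrightarrow> Q = P)}"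

definition ideal_power :: "('a, 'b) ring_scheme \<Rightarrow> 'a set \<Rightarrow> nat \<Rightarrow> 'a set" where
  "ideal_power R I t = I [^]\<^bsub>ideals_set R\<^esub> t"

definition embedded_primes :: "('a, 'b) ring_scheme \<Rightarrow> 'a set \<Rightarrow> nat \<Rightarrow> 'a set set" where
  "embedded_primes R I t =
     Ass R (ideal_quotient R (carrier R) (ideal_power R I t)) - minimal_primes R I"


section \<open>Localization and symbolic powers\<close>

definition frac_rel :: "('a, 'b) ring_scheme \<Rightarrow> 'a set \<Rightarrow> (('a \<times> 'a) \<times> ('a \<times> 'a)) set" where
  "frac_rel R S = {((a, s), (b, u)). a \<in> carrier R \<and> s \<in> S \<and> b \<in> carrier R \<and> u \<in> S \<and>
     (\<exists>w\<in>S. w \<otimes>\<^bsub>R\<^esub> (u \<otimes>\<^bsub>R\<^esub> a \<ominus>\<^bsub>R\<^esub> s \<otimes>\<^bsub>R\<^esub> b) = \<zero>\<^bsub>R\<^esub>)}"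

definition fraction :: "('a, 'b) ring_scheme \<Rightarrow> 'a set \<Rightarrow> 'a \<Rightarrow> 'a \<Rightarrow> ('a \<times> 'a) set" where
  "fraction R S a s = frac_rel R S `` {(a, s)}"

definition localization :: "('a, 'b) ring_scheme \<Rightarrow> 'a set \<Rightarrow> ('a \<times> 'a) set ring" where
  "localization R S =
    \<lparr>carrier = (carrier R \<times> S) // frac_rel R S,
     monoid.mult = (\<lambda>X Y. \<Union>(a, s)\<in>X. \<Union>(b, u)\<in>Y. fraction R S (a \<otimes>\<^bsub>R\<^esub> b) (s \<otimes>\<^bsub>R\<^esub> u)),
     one = fraction R S \<one>\<^bsub>R\<^esub> \<one>\<^bsub>R\<^esub>,
     ring.zero = fraction R S \<zero>\<^bsub>R\<^esub> \<one>\<^bsub>R\<^esub>,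
     add = (\<lambda>X Y. \<Union>(a, s)\<in>X. \<Union>(b, u)\<in>Y.
              fraction R S (u \<otimes>\<^bsub>R\<^esub> a \<oplus>\<^bsub>R\<^esub> s \<otimes>\<^bsub>R\<^esub> b) (s \<otimes>\<^bsub>R\<^esub> u))\<rparr>"

definition localization_at :: "('a, 'b) ring_scheme \<Rightarrow> 'a set \<Rightarrow> ('a \<times> 'a) set ring" where
  "localization_at R P = localization R (carrier R - P)"

definition to_localization_at :: "('a, 'b) ring_scheme \<Rightarrow> 'a set \<Rightarrow> 'a \<Rightarrow> ('a \<times> 'a) set" where
  "to_localization_at R P r = fraction R (carrier R - P) r \<one>\<^bsub>R\<^esub>"

text \<open>The extended ideal \<open>J R\<^sub>P\<close>.\<close>

definition extend_ideal_at :: "('a, 'b) ring_scheme \<Rightarrow> 'a set \<Rightarrow> 'a set \<Rightarrow> ('a \<times> 'a) set set" where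
  "extend_ideal_at R P J = genideal (localization_at R P) (to_localization_at R P ` J)"

definition symbolic_power :: "('a, 'b) ring_scheme \<Rightarrow> 'a set \<Rightarrow> nat \<Rightarrow> 'a set" where
  "symbolic_power R I t =
     {r \<in> carrier R. \<forall>P\<in>Ass R (ideal_quotient R (carrier R) I).
        to_localization_at R P r \<in> extend_ideal_at R P (ideal_power R I t)}"


section \<open>Local v-numbers\<close>

text \<open>
  \<open>D n\<close> is the degree \<open>n\<close> component of the graded module \<open>M\<close>. For a prime \<open>P\<close> an element with
  annihilator \<open>P\<close> is nonzero, so its degree is unambiguous. If no homogeneous element has
  annihilator \<open>P\<close>, the value is \<open>\<infinity>\<close>; otherwise the infimum is attained.
\<close>

definition local_v_number ::
    "('a, 'b) ring_scheme \<Rightarrow> ('a, 'm, 'c) module_scheme \<Rightarrow> (nat \<Rightarrow> 'm set) \<Rightarrow> 'a set \<Rightarrow> enat" where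
  "local_v_number R M D P = Inf {enat n | n m. m \<in> D n \<and> annihilator R M m = P}"

text \<open>The local v-number of \<open>N/J\<close>, for graded ideals \<open>J \<subseteq> N\<close>.\<close>

definition v_number_quotient ::
    "('a, 'b) ring_scheme \<Rightarrow> (nat \<Rightarrow> 'a set) \<Rightarrow> 'a set \<Rightarrow> 'a set \<Rightarrow> 'a set \<Rightarrow> enat" where
  "v_number_quotient R A N J P =
     local_v_number R (ideal_quotient R N J) (ideal_quotient_grading R A N J) P"

definition v_number_ideal ::
    "('a, 'b) ring_scheme \<Rightarrow> (nat \<Rightarrow> 'a set) \<Rightarrow> 'a set \<Rightarrow> 'a set \<Rightarrow> enat" where
  "v_number_ideal R A J P = v_number_quotient R A (carrier R) J P"

end

theory Submission
  imports Defs
begin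

text \<open>
  If \<open>I\<^sup>t : f = P\<close>, then \<open>f\<close> already lies in \<open>I\<^sup>(\<^sup>t\<^sup>)\<close>, so both v-numbers are infima of the same set of
  degrees. Indeed let \<open>Q \<in> Ass(R/I) = Min(I)\<close>. The prime \<open>P\<close> contains \<open>I\<close> and is not minimal over
  \<open>I\<close>, so \<open>P \<subseteq> Q\<close> would contradict the minimality of \<open>Q\<close>. Any \<open>s \<in> P - Q\<close> satisfies
  \<open>s f \<in> I\<^sup>t\<close> and is invertible in \<open>R\<^sub>Q\<close>, whence \<open>f \<in> I\<^sup>t R\<^sub>Q\<close>.
\<close>

section \<open>Annihilators and v-numbers in terms of ring elements\<close>

lemma (in ring) annihilator_ideal_quotient:
  assumes J: "ideal J R" and f: "f \<in> carrier R"
  shows "annihilator R (ideal_quotient R N J) (J +> f) = {r \<in> carrier R. r \<otimes> f \<in> J}"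
proof -
  interpret J: ideal J R by fact
  have smult: "r \<odot>\<^bsub>ideal_quotient R N J\<^esub> X = (\<Union>x\<in>X. J +> (r \<otimes> x))" for r X
    by (simp add: ideal_quotient_def quotient_module_def regular_module_def a_r_coset_defs)
  have zero: "\<zero>\<^bsub>ideal_quotient R N J\<^esub> = J"
    by (simp add: ideal_quotient_def quotient_module_def)
  have self: "f \<in> J +> f"
    using f by (rule J.a_rcos_self)
  have "(\<Union>x\<in>J +> f. J +> (r \<otimes> x)) = J \<longleftrightarrow> r \<otimes> f \<in> J" if r: "r \<in> carrier R" for r
  proof
    assume "(\<Union>x\<in>J +> f. J +> (r \<otimes> x)) = J"
    moreover have "r \<otimes> f \<in> J +> (r \<otimes> f)"
      using r f by (intro J.a_rcos_self) auto
    ultimately show "r \<otimes> f \<in> J"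
      using self by blast
  \<comment> \<open>The scalar multiple is a union over all representatives \<open>x\<close>, so
    every one of them has to give the coset \<open>J\<close>, not only \<open>f\<close>.\<close>
  next
    assume rf: "r \<otimes> f \<in> J"
    have "J +> (r \<otimes> x) = J" if x: "x \<in> J +> f" for x
    proof -
      obtain j where j: "j \<in> J" "x = j \<oplus> f"
        using x by (auto simp: a_r_coset_def')
      have "r \<otimes> x = r \<otimes> j \<oplus> r \<otimes> f"
        using j f r by (simp add: r_distr)
      then have "r \<otimes> x \<in> J"
        using rf j r by (simp add: J.I_l_closed J.a_closed)
      then show ?thesis
        by (rule J.a_rcos_const)
    qed
    then show "(\<Union>x\<in>J +> f. J +> (r \<otimes> x)) = J"
      using self by blast
  qed
  then show ?thesis
    by (simp add: annihilator_def smult zero cong: conj_cong)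
qed

text \<open>The graded pieces of the quotient are images of \<open>N \<inter> A n\<close>, so cosets
  can be traded for homogeneous representatives. Afterwards \<open>N\<close> enters only through the
  condition \<open>f \<in> N\<close>, which makes quotients with different \<open>N\<close>
  comparable.\<close>

lemma v_number_quotient_eq:
  assumes "ring R" "ideal J R" "N \<subseteq> carrier R"
  shows "v_number_quotient R A N J P =
    Inf {enat n | n f. f \<in> N \<inter> A n \<and> {r \<in> carrier R. r \<otimes>\<^bsub>R\<^esub> f \<in> J} = P}"
proof -
  have "annihilator R (ideal_quotient R N J) (J +>\<^bsub>R\<^esub> f) = {r \<in> carrier R. r \<otimes>\<^bsub>R\<^esub> f \<in> J}"
    if "f \<in> N \<inter> A n" for f n
    using that assms by (intro ring.annihilator_ideal_quotient) auto
  then have "(\<exists>m\<in>(\<lambda>f. J +>\<^bsub>R\<^esub> f) ` (N \<inter> A n). annihilator R (ideal_quotient R N J) m = P)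
      \<longleftrightarrow> (\<exists>f\<in>N \<inter> A n. {r \<in> carrier R. r \<otimes>\<^bsub>R\<^esub> f \<in> J} = P)" for n
    by (simp only: bex_simps cong: bex_cong)
  then show ?thesis
    by (simp add: v_number_quotient_def local_v_number_def ideal_quotient_grading_def Bex_def)
qed

section \<open>Powers of ideals\<close>

lemma (in ring) ideal_power_0 [simp]: "ideal_power R I 0 = carrier R"
  by (simp add: ideal_power_def ideals_set_def nat_pow_def)

lemma (in ring) ideal_power_Suc [simp]: "ideal_power R I (Suc t) = ideal_power R I t \<cdot> I"
  by (simp add: ideal_power_def ideals_set_def nat_pow_def)

lemma (in ring) ideal_ideal_power:
  "ideal I R \<Longrightarrow> ideal (ideal_power R I t) R"
  by (induction t) (auto simp: oneideal ideal_prod_is_ideal)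

text \<open>If some \<open>x \<in> J\<close> lies outside the prime \<open>I\<close>, primality
  cancels \<open>x\<close> from products \<open>y \<otimes> x \<in> I\<close>, which lowers the
  exponent. The descent ends at exponent 0, where the power is the whole ring and cannot lie in
  \<open>I\<close>.\<close>

lemma (in primeideal) ideal_power_subset_imp_subset:
  assumes J: "ideal J R" and "ideal_power R J t \<subseteq> I"
  shows "J \<subseteq> I"
  using assms(2)
proof (induction t)
  case 0
  then show ?case
    using I_notcarr a_subset by auto
next
  case (Suc t)
  show ?case
  proof (rule ccontr)
    assume nsub: "\<not> J \<subseteq> I"
    then obtain x where x: "x \<in> J" "x \<notin> I" by blast
    have "y \<in> I" if y: "y \<in> ideal_power R J t" for y
    proof -
      have "y \<otimes> x \<in> I"
        using Suc.prems ideal_prod.prod[OF y x(1), of R] by auto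
      then show ?thesis
        using I_prime y x J ideal_ideal_power[OF J] by (meson ideal.Icarr)
    qed
    then show False
      using Suc.IH nsub by blast
  qed
qed

section \<open>Arithmetic of fractions\<close>

lemma (in cring) frac_rel_iff:
  assumes "S \<subseteq> carrier R"
  shows "((a, s), (b, u)) \<in> frac_rel R S \<longleftrightarrow>
    a \<in> carrier R \<and> s \<in> S \<and> b \<in> carrier R \<and> u \<in> S \<and>
    (\<exists>w\<in>S. w \<otimes> (u \<otimes> a) = w \<otimes> (s \<otimes> b))"
proof -
  have "w \<otimes> (u \<otimes> a \<ominus> s \<otimes> b) = \<zero> \<longleftrightarrow> w \<otimes> (u \<otimes> a) = w \<otimes> (s \<otimes> b)"
    if "w \<in> carrier R" "a \<in> carrier R" "b \<in> carrier R" "s \<in> carrier R" "u \<in> carrier R" for w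
  proof -
    have "w \<otimes> (u \<otimes> a \<ominus> s \<otimes> b) = w \<otimes> (u \<otimes> a) \<ominus> w \<otimes> (s \<otimes> b)"
      using that by algebra
    then show ?thesis
      using that by simp
  qed
  then show ?thesis
    using assms unfolding frac_rel_def by blast
qed

lemma (in cring) equiv_frac_rel:
  assumes "submonoid S R"
  shows "equiv (carrier R \<times> S) (frac_rel R S)"
proof -
  interpret S: submonoid S R by fact
  note iff = frac_rel_iff[OF S.subset]
  have in_carrier: "s \<in> carrier R" if "s \<in> S" for s
    using that S.subset by blast
  show ?thesis
  proof (rule equivI)
    show "frac_rel R S \<subseteq> (carrier R \<times> S) \<times> carrier R \<times> S"
      by (auto simp: frac_rel_def)
    show "refl_on (carrier R \<times> S) (frac_rel R S)"
      unfolding refl_on_def using S.one_closed by (auto simp: iff)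
    show "sym (frac_rel R S)"
      unfolding sym_def by (auto simp: iff; metis)
    show "trans (frac_rel R S)"
    proof (rule transI, clarify)
      fix a s b u c v
      assume "((a, s), (b, u)) \<in> frac_rel R S" "((b, u), (c, v)) \<in> frac_rel R S"
      then obtain w z where S: "s \<in> S" "u \<in> S" "v \<in> S" "w \<in> S" "z \<in> S"
        and R: "a \<in> carrier R" "b \<in> carrier R" "c \<in> carrier R"
        and w: "w \<otimes> (u \<otimes> a) = w \<otimes> (s \<otimes> b)" and z: "z \<otimes> (v \<otimes> b) = z \<otimes> (u \<otimes> c)"
        by (auto simp: iff)
      note R = R S[THEN in_carrier]
      \<comment> \<open>The witness needs the middle denominator \<open>u\<close> besides
        \<open>w\<close> and \<open>z\<close>: it supplies the \<open>u\<close> in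
        \<open>w \<otimes> (u \<otimes> a)\<close>, and it reappears when \<open>z\<close> is
        applied.\<close>
      have "(w \<otimes> z \<otimes> u) \<otimes> (v \<otimes> a) = (z \<otimes> v) \<otimes> (w \<otimes> (u \<otimes> a))"
        using R by algebra
      also have "\<dots> = (w \<otimes> s) \<otimes> (z \<otimes> (v \<otimes> b))"
        unfolding w using R by algebra
      also have "\<dots> = (w \<otimes> z \<otimes> u) \<otimes> (s \<otimes> c)"
        unfolding z using R by algebra
      finally show "((a, s), (c, v)) \<in> frac_rel R S"
        using R S by (auto simp: iff intro!: bexI[of _ "w \<otimes> z \<otimes> u"])
    qed
  qed
qed

text \<open>The product in the localization is a union over all pairs of representatives, so the
  point is that each pair gives the same class. The product of the two witnesses shows this.\<close>

lemma (in cring) fraction_mult: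
  assumes "submonoid S R" "a \<in> carrier R" "b \<in> carrier R" "s \<in> S" "u \<in> S"
  shows "fraction R S a s \<otimes>\<^bsub>localization R S\<^esub> fraction R S b u = fraction R S (a \<otimes> b) (s \<otimes> u)"
proof -
  interpret S: submonoid S R by fact
  note iff = frac_rel_iff[OF S.subset]
  note equiv = equiv_frac_rel[OF assms(1)]
  have in_carrier: "s \<in> carrier R" if "s \<in> S" for s
    using that S.subset by blast
  have "fraction R S (a' \<otimes> b') (s' \<otimes> u') = fraction R S (a \<otimes> b) (s \<otimes> u)"
    if "((a, s), (a', s')) \<in> frac_rel R S" "((b, u), (b', u')) \<in> frac_rel R S" for a' s' b' u'
  proof -
    obtain w z where S: "s' \<in> S" "u' \<in> S" "w \<in> S" "z \<in> S"
      and R: "a' \<in> carrier R" "b' \<in> carrier R"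
      and w: "w \<otimes> (s' \<otimes> a) = w \<otimes> (s \<otimes> a')" and z: "z \<otimes> (u' \<otimes> b) = z \<otimes> (u \<otimes> b')"
      using \<open>((a, s), (a', s')) \<in> frac_rel R S\<close> \<open>((b, u), (b', u')) \<in> frac_rel R S\<close>
      by (auto simp: iff)
    note R = R assms(2,3) S[THEN in_carrier] assms(4,5)[THEN in_carrier]
    have "(w \<otimes> z) \<otimes> ((s' \<otimes> u') \<otimes> (a \<otimes> b)) = (w \<otimes> (s' \<otimes> a)) \<otimes> (z \<otimes> (u' \<otimes> b))"
      using R by algebra
    also have "\<dots> = (w \<otimes> z) \<otimes> ((s \<otimes> u) \<otimes> (a' \<otimes> b'))"
      unfolding w z using R by algebra
    finally have "((a \<otimes> b, s \<otimes> u), (a' \<otimes> b', s' \<otimes> u')) \<in> frac_rel R S"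
      using R S assms(4,5) by (auto simp: iff intro!: bexI[of _ "w \<otimes> z"])
    then show ?thesis
      unfolding fraction_def using equiv_class_eq[OF equiv] by blast
  qed
  \<comment> \<open>Reflexivity makes both classes nonempty, so the union of equal sets is that set
    and not empty.\<close>
  moreover have "((a, s), (a, s)) \<in> frac_rel R S" "((b, u), (b, u)) \<in> frac_rel R S"
    using assms equiv by (auto simp: equiv_def refl_on_def)
  ultimately have "(\<Union>(a', s')\<in>fraction R S a s. \<Union>(b', u')\<in>fraction R S b u.
      fraction R S (a' \<otimes> b') (s' \<otimes> u')) = fraction R S (a \<otimes> b) (s \<otimes> u)"
    unfolding fraction_def[of R S a s] fraction_def[of R S b u] by fast
  then show ?thesis
    by (simp add: localization_def)
qed

lemma (in primeideal) submonoid_compl: "submonoid (carrier R - I) R"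
proof
  show "\<one> \<in> carrier R - I"
    using I_notcarr one_imp_carrier by auto
qed (use I_prime in auto)

text \<open>
  The generated ideal is the intersection of all ideals containing the generators, and an ideal of
  a structure presupposes that the structure is a ring; hence the ring axioms of the localization
  are not needed here.
\<close>

lemma (in primeideal) to_localization_at_mem_extend_ideal_at:
  assumes s: "s \<in> carrier R - I" and f: "f \<in> carrier R" and sf: "s \<otimes> f \<in> J"
  shows "to_localization_at R I f \<in> extend_ideal_at R I J"
proof -
  let ?S = "carrier R - I"
  note S = submonoid_compl
  have one: "\<one> \<in> ?S"
    using submonoid.one_closed[OF S] .
  have "fraction R ?S f \<one> \<in> K"
    if K: "ideal K (localization R ?S)" "to_localization_at R I ` J \<subseteq> K" for K
  proof -
    have "fraction R ?S (s \<otimes> f) \<one> \<in> K"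
      using K(2) sf by (auto simp: to_localization_at_def)
    \<comment> \<open>Since \<open>s\<close> lies outside the prime, \<open>1/s\<close> exists;
      multiplying \<open>(s f)/1\<close> by it and cancelling \<open>s\<close> recovers
      \<open>f/1\<close>.\<close>
    moreover have "fraction R ?S \<one> s \<in> carrier (localization R ?S)"
      using s by (simp add: localization_def fraction_def quotientI)
    ultimately have "fraction R ?S \<one> s \<otimes>\<^bsub>localization R ?S\<^esub> fraction R ?S (s \<otimes> f) \<one> \<in> K"
      using K(1) by (simp add: ideal.I_l_closed)
    moreover have "fraction R ?S \<one> s \<otimes>\<^bsub>localization R ?S\<^esub> fraction R ?S (s \<otimes> f) \<one>
        = fraction R ?S (s \<otimes> f) s"
      using fraction_mult[OF S, of \<one> "s \<otimes> f" s \<one>] s f one by simp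
    moreover have "((s \<otimes> f, s), (f, \<one>)) \<in> frac_rel R ?S"
      using s f one by (subst frac_rel_iff) auto
    then have "fraction R ?S (s \<otimes> f) s = fraction R ?S f \<one>"
      unfolding fraction_def by (rule equiv_class_eq[OF equiv_frac_rel[OF S]])
    ultimately show ?thesis
      by simp
  qed
  then show ?thesis
    by (simp add: to_localization_at_def extend_ideal_at_def localization_at_def genideal_def)
qed

section \<open>Symbolic powers and v-numbers\<close>

lemma (in cring) mem_symbolic_power_if_colon_embedded:
  assumes I: "ideal I R"
    and Ass: "Ass R (ideal_quotient R (carrier R) I) = minimal_primes R I"
    and P: "primeideal P R" "P \<notin> minimal_primes R I"
    and f: "f \<in> carrier R" "{r \<in> carrier R. r \<otimes> f \<in> ideal_power R I t} = P"
  shows "f \<in> symbolic_power R I t"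
proof -
  \<comment> \<open>An ideal absorbs multiplication by \<open>f\<close>, so it is contained in its
    colon by \<open>f\<close>, which is \<open>P\<close>.\<close>
  have "ideal_power R I t \<subseteq> P"
    using ideal_ideal_power[OF I, of t] f by (auto simp: ideal.Icarr ideal.I_r_closed)
  then have "I \<subseteq> P"
    using primeideal.ideal_power_subset_imp_subset[OF P(1) I] by blast
  \<comment> \<open>By \<open>Ass\<close>, the minimal primes \<open>Q\<close> are exactly those
    over which \<open>symbolic_power\<close> quantifies.\<close>
  have "to_localization_at R Q f \<in> extend_ideal_at R Q (ideal_power R I t)"
    if "Q \<in> minimal_primes R I" for Q
  proof -
    have Q: "primeideal Q R"
      using that by (simp add: minimal_primes_def)
    have "P = Q" if "P \<subseteq> Q"
      using that \<open>Q \<in> minimal_primes R I\<close> P(1) \<open>I \<subseteq> P\<close> unfolding minimal_primes_def by blast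
    then have "\<not> P \<subseteq> Q"
      using \<open>Q \<in> minimal_primes R I\<close> P(2) by blast
    then obtain s where "s \<in> carrier R - Q" "s \<otimes> f \<in> ideal_power R I t"
      using f(2) by blast
    then show ?thesis
      using primeideal.to_localization_at_mem_extend_ideal_at[OF Q] f(1) by blast
  qed
  then show ?thesis
    using f(1) by (simp add: symbolic_power_def Ass)
qed

theorem theorem3p1:
  fixes R :: "('a, 'b) ring_scheme"
    and A :: "nat \<Rightarrow> 'a set"
    and I P :: "'a set"
    and t :: nat
  assumes "standard_graded_ring R A"
    and "noetherian_ring R"
    and "subfield (A 0) R"
    and "graded_ideal R A I"
    and "I \<noteq> {\<zero>\<^bsub>R\<^esub>}"
    and "I \<noteq> carrier R"
    and "Ass R (ideal_quotient R (carrier R) I) = minimal_primes R I"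
    and "t \<ge> 1"
    and "P \<in> embedded_primes R I t"
  shows "v_number_quotient R A (symbolic_power R I t) (ideal_power R I t) P
       = v_number_ideal R A (ideal_power R I t) P"
proof -
  have R: "cring R"
    using assms(1) by (simp add: standard_graded_ring_def graded_ring_def)
  then interpret cring R .
  have I: "ideal I R"
    using assms(4) by (simp add: graded_ideal_def)
  have P: "primeideal P R" "P \<notin> minimal_primes R I"
    using assms(9) by (auto simp: embedded_primes_def Ass_def)
  have J: "ideal (ideal_power R I t) R"
    using I by (rule ideal_ideal_power)
  have sub: "symbolic_power R I t \<subseteq> carrier R"
    by (auto simp: symbolic_power_def)
  \<comment> \<open>The two infima range over the same degrees: the colon condition forces
    \<open>f\<close> into the symbolic power, and \<open>sub\<close> gives the converse.\<close>
  have "f \<in> symbolic_power R I t \<inter> A n \<and> {r \<in> carrier R. r \<otimes>\<^bsub>R\<^esub> f \<in> ideal_power R I t} = P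
      \<longleftrightarrow> f \<in> carrier R \<inter> A n \<and> {r \<in> carrier R. r \<otimes>\<^bsub>R\<^esub> f \<in> ideal_power R I t} = P" for f n
    using mem_symbolic_power_if_colon_embedded[OF I assms(7) P] sub by blast
  then show ?thesis
    unfolding v_number_ideal_def v_number_quotient_eq[OF ring_axioms J sub]
      v_number_quotient_eq[OF ring_axioms J order_refl] by simp
qed

end
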